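(* Let $n \ge 1$ and let $i = \frac{3^n+1}{2} + \frac{3^j-1}{2} + \frac{3^k-1}{2}$, where $0 \le j \le k \le n-1$ are integers. Then $$\binom{3i - \frac{3^n-1}{2}}{i - \frac{3^n+1}{2}} \equiv \begin{cases} 1 \pmod 3 & \text{if } j = k, \\ 2 \pmod 3 & \text{if } j < k. \end{cases}$$ *)

theory Defs
  imports Main "HOL-Number_Theory.Cong"
begin

end

theory Submission
  imports Defs "HOL-Computational_Algebra.Primes"
begin

text \<open>
  Let \<open>R m = (3 ^ m - 1) / 2\<close>, whose base 3 expansion consists of \<open>m\<close> ones. The binomial
  coefficient is \<open>(3 ^ n + R (j + 1) + R (k + 1)) choose (R j + R k)\<close>. In base 3, from the least
  significant digit on, the upper number starts with \<open>j + 1\<close> twos and \<open>k - j\<close> ones, the lower one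
  with \<open>j\<close> twos and \<open>k - j\<close> ones. By Lucas' congruence the coefficient is the product of the
  digitwise ones, all of which are 1 except for \<open>2 choose 1\<close> at position \<open>j\<close> when \<open>j < k\<close>.
\<close>

text \<open>Modulo \<open>p\<close>, \<open>(1 + X) ^ p\<close> is \<open>1 + X ^ p\<close>: in
  Vandermonde's sum, \<open>p\<close> divides \<open>p choose i\<close> for
  \<open>0 < i < p\<close>, so only the terms \<open>i = 0\<close> and \<open>i = p\<close>
  survive.\<close>

lemma prime_add_choose_cong:
  fixes p n m :: nat
  assumes "prime p"
  shows "[(p + n) choose m = (n choose m) + (if p \<le> m then n choose (m - p) else 0)] (mod p)"
proof -
  let ?f = "\<lambda>i. (if i = 0 then n choose m else 0) + (if i = p then n choose (m - p) else 0)"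
  have "p \<noteq> 0"
    using assms by (metis not_prime_0)
  have "[(\<Sum>i\<le>m. (p choose i) * (n choose (m - i))) = (\<Sum>i\<le>m. ?f i)] (mod p)"
  proof (rule cong_sum)
    fix i
    consider "i = 0" | "i = p" | "0 < i" "i < p" | "p < i"
      by linarith
    then show "[(p choose i) * (n choose (m - i)) = ?f i] (mod p)"
    proof cases
      case 3
      then have "p dvd (p choose i)"
        using assms by (intro dvd_choose_prime) auto
      with 3 show ?thesis
        by (simp add: cong_0_iff)
    qed (use \<open>p \<noteq> 0\<close> in \<open>simp_all add: binomial_eq_0\<close>)
  qed
  also have "(\<Sum>i\<le>m. ?f i) = (n choose m) + (if p \<le> m then n choose (m - p) else 0)"
    by (simp add: sum.distrib)
  finally show ?thesis
    by (simp add: vandermonde)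
qed

text \<open>Raising \<open>a\<close> by one adds \<open>p\<close> to the upper number, and the
  preceding congruence then turns into Pascal's rule for \<open>Suc a choose b\<close>.\<close>

lemma lucas_step:
  fixes p a b r s :: nat
  assumes "prime p" "r < p" "s < p"
  shows "[(p * a + r) choose (p * b + s) = (a choose b) * (r choose s)] (mod p)"
proof (induction a arbitrary: b)
  case 0
  show ?case
  proof (cases b)
    case (Suc b')
    then have "r < p * b + s"
      using assms by simp
    with Suc show ?thesis
      by (simp add: binomial_eq_0)
  qed simp
next
  case (Suc a)
  have split: "[(p * Suc a + r) choose (p * b + s) = ((p * a + r) choose (p * b + s)) +
      (if p \<le> p * b + s then (p * a + r) choose (p * b + s - p) else 0)] (mod p)"
    using prime_add_choose_cong[OF assms(1), of "p * a + r" "p * b + s"] by (simp add: add.assoc)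
  show ?case
  proof (cases b)
    \<comment> \<open>Here \<open>s < p\<close> removes the second summand of
      \<open>split\<close>.\<close>
    case 0
    then show ?thesis
      using split Suc.IH[of 0] assms by (auto intro: cong_trans)
  next
    case b: (Suc b')
    have "[((p * a + r) choose (p * b + s)) + ((p * a + r) choose (p * b' + s)) =
        (a choose b) * (r choose s) + (a choose b') * (r choose s)] (mod p)"
      by (intro cong_add Suc.IH)
    then show ?thesis
      using split b by (auto intro: cong_trans simp: algebra_simps)
  qed
qed

definition repunit3 :: "nat \<Rightarrow> nat" where
  "repunit3 m = (3 ^ m - 1) div 2"

lemma two_repunit3: "2 * repunit3 m + 1 = 3 ^ m"
proof -
  have "odd ((3::nat) ^ m)"
    by simp
  then show ?thesis
    unfolding repunit3_def by (elim oddE) simp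
qed

lemma repunit3_0 [simp]: "repunit3 0 = 0"
  by (simp add: repunit3_def)

lemma repunit3_Suc: "repunit3 (Suc m) = 3 * repunit3 m + 1"
  using two_repunit3[of m] two_repunit3[of "Suc m"] by simp

text \<open>Each Lucas step strips a digit 1 from both numbers, with factor
  \<open>1 choose 1\<close>. The digits of \<open>c\<close> lie above those of the lower number and
  never matter.\<close>

lemma choose_repunit3_cong:
  "[(c * 3 ^ Suc k + repunit3 (Suc k)) choose repunit3 k = 1] (mod 3)"
proof (induction k)
  case (Suc k)
  have "[(3 * (c * 3 ^ Suc k + repunit3 (Suc k)) + 1) choose (3 * repunit3 k + 1) =
      ((c * 3 ^ Suc k + repunit3 (Suc k)) choose repunit3 k) * (1 choose 1)] (mod 3)"
    by (rule lucas_step) auto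
  also have "[((c * 3 ^ Suc k + repunit3 (Suc k)) choose repunit3 k) * (1 choose 1) = 1] (mod 3)"
    using Suc.IH by simp
  finally show ?case
    by (simp add: repunit3_Suc[of "Suc k"] repunit3_Suc[of k] algebra_simps)
qed simp

text \<open>Stripping a digit 2 from both numbers lowers \<open>j\<close> and \<open>k\<close>
  together, with factor \<open>2 choose 2\<close>, until \<open>j = 0\<close>.\<close>

lemma choose_repunit3_add_cong:
  assumes "j \<le> k"
  shows "[(c * 3 ^ Suc k + repunit3 (Suc j) + repunit3 (Suc k)) choose (repunit3 j + repunit3 k)
    = (if j = k then 1 else 2)] (mod 3)"
  using assms
proof (induction j arbitrary: k)
  case 0
  show ?case
  proof (cases k)
    \<comment> \<open>With \<open>j = 0 < k\<close> the last digits are 2 above and 1 below: this is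
      the only source of the factor 2.\<close>
    case (Suc l)
    have "[(3 * (c * 3 ^ Suc l + repunit3 (Suc l)) + 2) choose (3 * repunit3 l + 1) =
        ((c * 3 ^ Suc l + repunit3 (Suc l)) choose repunit3 l) * (2 choose 1)] (mod 3)"
      by (rule lucas_step) auto
    also have "[((c * 3 ^ Suc l + repunit3 (Suc l)) choose repunit3 l) * (2 choose 1) =
        1 * (2 choose 1)] (mod 3)"
      by (intro cong_mult choose_repunit3_cong cong_refl)
    finally show ?thesis
      using Suc by (simp add: repunit3_Suc algebra_simps numeral_2_eq_2)
  qed simp
next
  case (Suc j)
  then obtain l where l: "k = Suc l" "j \<le> l"
    by (cases k) auto
  let ?a = "c * 3 ^ Suc l + repunit3 (Suc j) + repunit3 (Suc l)"
  let ?b = "repunit3 j + repunit3 l"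
  have "[(3 * ?a + 2) choose (3 * ?b + 2) = (?a choose ?b) * (2 choose 2)] (mod 3)"
    by (rule lucas_step) auto
  also have "[(?a choose ?b) * (2 choose 2) = (if j = l then 1 else 2)] (mod 3)"
    using Suc.IH[OF l(2)] by simp
  also have "3 * ?a + 2 = c * 3 ^ Suc k + repunit3 (Suc (Suc j)) + repunit3 (Suc k)"
    unfolding l by (simp add: repunit3_Suc[of "Suc _"])
  also have "3 * ?b + 2 = repunit3 (Suc j) + repunit3 k"
    unfolding l by (simp add: repunit3_Suc)
  finally show ?case
    by (simp add: l)
qed

theorem theorem5:
  fixes n i j k :: nat
  assumes "n \<ge> 1"
    and "j \<le> k" and "k \<le> n - 1"
    and "i = (3 ^ n + 1) div 2 + (3 ^ j - 1) div 2 + (3 ^ k - 1) div 2"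
  shows "[(3 * i - (3 ^ n - 1) div 2) choose (i - (3 ^ n + 1) div 2) = (if j = k then 1 else 2)] (mod 3)"
proof -
  have half: "(3 ^ n + 1) div 2 = repunit3 n + 1"
    by (simp flip: two_repunit3)
  have i: "i = repunit3 n + 1 + repunit3 j + repunit3 k"
    using assms(4) unfolding half by (simp add: repunit3_def)
  have "Suc k \<le> n"
    using assms(1,3) by simp
  \<comment> \<open>The leading digit of \<open>3 ^ n\<close> lies above position \<open>k\<close>,
    so it can be absorbed into \<open>c\<close>.\<close>
  then have "(3::nat) ^ n = 3 ^ (n - Suc k) * 3 ^ Suc k"
    by (metis le_add_diff_inverse2 power_add)
  \<comment> \<open>The 3 in \<open>3 * i\<close> supplies the 1 in
    \<open>3 ^ n = 2 * repunit3 n + 1\<close> and the 1 in each of the two longer repunits.\<close>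
  moreover have "3 * i - (3 ^ n - 1) div 2 = 3 ^ n + repunit3 (Suc j) + repunit3 (Suc k)"
    unfolding i repunit3_def[of n, symmetric]
    using two_repunit3[of n] by (simp add: repunit3_Suc)
  moreover have "i - (3 ^ n + 1) div 2 = repunit3 j + repunit3 k"
    unfolding half i by simp
  ultimately show ?thesis
    using choose_repunit3_add_cong[OF assms(2), of "3 ^ (n - Suc k)"] by simp
qed

end
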